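(* Let $X=\mathbb{Z}_n$ be a dihedral quandle, let $\mathbbm{k}$ be a field of characteristic $0$, and let $\mathcal{A}=\mathbbm{k}[X]$ be its quandle algebra. Represent a derivation $D$ of $\mathcal{A}$ by the $n\times n$ matrix whose entry in row $t$ and column $x$ ($t,x=0,1,\dots,n-1$) is $c_t^x$, where $D(e_t)=\sum_x c_t^x e_x$. Then: 1) If $n=4k$ for some positive integer $k$, the matrix of any derivation $D$ can be written as $$D=\begin{pmatrix}P&-P\\-P&P\end{pmatrix}$$ for some matrix $P$ of size $2k\times 2k$. 2) If $n=2k$ for some odd positive integer $k$, the matrix of any derivation $D$ can be written as $$D=\begin{pmatrix}R&-R\end{pmatrix}$$ for some matrix $R$ of size $2k\times k$.
   Context: A quandle is a set $X$ with a binary operation $\triangleright$ such that (I) $x\triangleright x=x$ for all $x$; (II) for all $y,z$ there is a unique $x$ with $x\triangleright y=z$; (III) $(x\triangleright y)\triangleright z=(x\triangleright z)\triangleright(y\triangleright z)$ for all $x,y,z$. The dihedral quandle $\mathbb{Z}_n$ is the set of integers modulo $n$ with $x\triangleright y=2y-x$. For a field $\mathbbm{k}$, the quandle algebra $\mathbbm{k}[X]$ is the (generally nonassociative) $\mathbbm{k}$-algebra with basis $\{e_x\}_{x\in X}$ and bilinear product determined by $e_x\cdot e_y=e_{x\triangleright y}$. A derivation of an algebra $A$ is a linear map $D:A\to A$ with $D(a\cdot b)=D(a)\cdot b+a\cdot D(b)$ for all $a,b\in A$. *)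

theory Defs
  imports
    "HOL-Library.Poly_Mapping"
    "Jordan_Normal_Form.Matrix"
begin

definition quandle :: "'a set \<Rightarrow> ('a \<Rightarrow> 'a \<Rightarrow> 'a) \<Rightarrow> bool" where
  "quandle X op \<longleftrightarrow>
     (\<forall>x\<in>X. \<forall>y\<in>X. op x y \<in> X) \<and>
     (\<forall>x\<in>X. op x x = x) \<and>
     (\<forall>y\<in>X. \<forall>z\<in>X. \<exists>!x. x \<in> X \<and> op x y = z) \<and>
     (\<forall>x\<in>X. \<forall>y\<in>X. \<forall>z\<in>X. op (op x y) z = op (op x z) (op y z))"

text \<open>The integers modulo \<open>n\<close> are represented by their least nonnegative residues;
  this is meant for \<open>n > 0\<close> only.\<close>

definition dihedral_set :: "nat \<Rightarrow> int set" where
  "dihedral_set n = {0..<int n}"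

definition dihedral_op :: "nat \<Rightarrow> int \<Rightarrow> int \<Rightarrow> int" where
  "dihedral_op n x y = (2 * y - x) mod int n"

lemma quandle_dihedral: "quandle (dihedral_set n) (dihedral_op n)"
proof (cases "n = 0")
  case True
  then show ?thesis by (simp add: quandle_def dihedral_set_def)
next
  case False
  then have n: "int n > 0" by simp
  have ex1: "\<exists>!x. x \<in> {0..<int n} \<and> (2 * y - x) mod int n = z"
    if z: "z \<in> {0..<int n}" for y z
  proof (rule ex1I[of _ "(2 * y - z) mod int n"])
    have "(2 * y - (2 * y - z) mod int n) mod int n = z mod int n"
      by (simp add: mod_diff_right_eq)
    then show "(2 * y - z) mod int n \<in> {0..<int n} \<and>
        (2 * y - (2 * y - z) mod int n) mod int n = z"
      using n z by simp
  next
    fix x assume x: "x \<in> {0..<int n} \<and> (2 * y - x) mod int n = z"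
    then have "(2 * y - z) mod int n = x mod int n"
      by (auto simp: mod_diff_right_eq)
    then show "x = (2 * y - z) mod int n" using x by simp
  qed
  have 2: "\<forall>y\<in>dihedral_set n. \<forall>z\<in>dihedral_set n.
      \<exists>!x. x \<in> dihedral_set n \<and> dihedral_op n x y = z"
    unfolding dihedral_set_def dihedral_op_def by (intro ballI ex1)
  have 3: "dihedral_op n (dihedral_op n x y) z =
      dihedral_op n (dihedral_op n x z) (dihedral_op n y z)" for x y z
  proof -
    have "dihedral_op n (dihedral_op n x z) (dihedral_op n y z)
        = (2 * (2 * z - y) - (2 * z - x)) mod int n"
      unfolding dihedral_op_def by (rule mod_diff_cong) (simp_all add: mod_mult_right_eq)
    also have "2 * (2 * z - y) - (2 * z - x) = 2 * z - (2 * y - x)"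
      by simp
    also have "\<dots> mod int n = dihedral_op n (dihedral_op n x y) z"
      by (simp add: dihedral_op_def mod_diff_right_eq)
    finally show ?thesis ..
  qed
  have 1: "\<forall>x\<in>dihedral_set n. \<forall>y\<in>dihedral_set n. dihedral_op n x y \<in> dihedral_set n"
      "\<forall>x\<in>dihedral_set n. dihedral_op n x x = x"
    using n by (auto simp: dihedral_set_def dihedral_op_def)
  show ?thesis
    unfolding quandle_def by (intro conjI 1 2 ballI 3)
qed

text \<open>Elements of the quandle algebra are finitely supported functions with support in \<open>X\<close>;
  the basis vector \<open>e\<^sub>x\<close> is \<^term>\<open>Poly_Mapping.single x 1\<close>. The product is not the
  convolution \<open>*\<close> of the library, which is based on addition of indices.\<close>

definition quandle_algebra :: "'a set \<Rightarrow> ('a \<Rightarrow>\<^sub>0 'k::field) set" where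
  "quandle_algebra X = {f. Poly_Mapping.keys f \<subseteq> X}"

definition qbasis :: "'a \<Rightarrow> 'a \<Rightarrow>\<^sub>0 'k::field" where
  "qbasis x = Poly_Mapping.single x 1"

definition qscale :: "'k::field \<Rightarrow> ('a \<Rightarrow>\<^sub>0 'k) \<Rightarrow> 'a \<Rightarrow>\<^sub>0 'k" where
  "qscale c f = Poly_Mapping.map ((*) c) f"

definition qmult :: "('a \<Rightarrow> 'a \<Rightarrow> 'a) \<Rightarrow> ('a \<Rightarrow>\<^sub>0 'k::field) \<Rightarrow> ('a \<Rightarrow>\<^sub>0 'k) \<Rightarrow> 'a \<Rightarrow>\<^sub>0 'k" where
  "qmult op f g = (\<Sum>x\<in>Poly_Mapping.keys f. \<Sum>y\<in>Poly_Mapping.keys g.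
     Poly_Mapping.single (op x y) (Poly_Mapping.lookup f x * Poly_Mapping.lookup g y))"

lemma lookup_qscale: "Poly_Mapping.lookup (qscale c f) x = c * Poly_Mapping.lookup f x"
  by (simp add: qscale_def Poly_Mapping.map.rep_eq when_def)

lemma qmult_qbasis: "qmult op (qbasis x) (qbasis y) = (qbasis (op x y) :: 'a \<Rightarrow>\<^sub>0 'k::field)"
  by (simp add: qmult_def qbasis_def)

lemma qmult_superset:
  assumes "finite S" "Poly_Mapping.keys f \<subseteq> S" "finite T" "Poly_Mapping.keys g \<subseteq> T"
  shows "qmult op f g = (\<Sum>x\<in>S. \<Sum>y\<in>T.
     Poly_Mapping.single (op x y) (Poly_Mapping.lookup f x * Poly_Mapping.lookup g y))"
proof -
  have "qmult op f g = (\<Sum>x\<in>Poly_Mapping.keys f. \<Sum>y\<in>T.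
     Poly_Mapping.single (op x y) (Poly_Mapping.lookup f x * Poly_Mapping.lookup g y))"
    unfolding qmult_def using assms
    by (intro sum.cong[OF refl], intro sum.mono_neutral_left) (auto simp: in_keys_iff)
  also have "\<dots> = (\<Sum>x\<in>S. \<Sum>y\<in>T.
     Poly_Mapping.single (op x y) (Poly_Mapping.lookup f x * Poly_Mapping.lookup g y))"
    using assms by (intro sum.mono_neutral_left) (auto simp: in_keys_iff)
  finally show ?thesis .
qed

lemma qmult_add_left: "qmult op (f + f') g = qmult op f g + qmult op f' g"
proof -
  let ?S = "Poly_Mapping.keys f \<union> Poly_Mapping.keys f'"
  have "Poly_Mapping.keys (f + f') \<subseteq> ?S" by (rule Poly_Mapping.keys_add)
  then show ?thesis
    by (simp add: qmult_superset[of ?S _ "Poly_Mapping.keys g"] lookup_add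
        distrib_right single_add sum.distrib)
qed

lemma qmult_add_right: "qmult op f (g + g') = qmult op f g + qmult op f g'"
proof -
  let ?T = "Poly_Mapping.keys g \<union> Poly_Mapping.keys g'"
  have "Poly_Mapping.keys (g + g') \<subseteq> ?T" by (rule Poly_Mapping.keys_add)
  then show ?thesis
    by (simp add: qmult_superset[of "Poly_Mapping.keys f" _ ?T] lookup_add
        distrib_left single_add sum.distrib)
qed

lemma qscale_add: "qscale c (f + g) = qscale c f + qscale c g"
  by (rule poly_mapping_eqI) (simp add: lookup_qscale lookup_add distrib_left)

lemma qscale_single: "qscale c (Poly_Mapping.single x a) = Poly_Mapping.single x (c * a)"
  by (rule poly_mapping_eqI) (simp add: lookup_qscale lookup_single when_def)

lemma qscale_sum: "qscale c (sum h S) = (\<Sum>i\<in>S. qscale c (h i))"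
proof (induction S rule: infinite_finite_induct)
  case (insert x F)
  then show ?case by (simp add: qscale_add)
qed (auto intro: poly_mapping_eqI simp: lookup_qscale)

lemma keys_qscale: "Poly_Mapping.keys (qscale c f) \<subseteq> Poly_Mapping.keys f"
  by (auto simp: in_keys_iff lookup_qscale)

lemma qmult_qscale_left: "qmult op (qscale c f) g = qscale c (qmult op f g)"
  by (simp add: qmult_superset[of "Poly_Mapping.keys f" _ "Poly_Mapping.keys g"] keys_qscale
      lookup_qscale qscale_sum qscale_single mult.assoc)

lemma qmult_qscale_right: "qmult op f (qscale c g) = qscale c (qmult op f g)"
  by (simp add: qmult_superset[of "Poly_Mapping.keys f" _ "Poly_Mapping.keys g"] keys_qscale
      lookup_qscale qscale_sum qscale_single mult.left_commute)

lemma qmult_closed: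
  assumes "quandle X op" "f \<in> quandle_algebra X" "g \<in> quandle_algebra X"
  shows "qmult op f g \<in> quandle_algebra X"
proof -
  have "Poly_Mapping.keys (qmult op f g) \<subseteq>
      (\<Union>x\<in>Poly_Mapping.keys f. \<Union>y\<in>Poly_Mapping.keys g. {op x y})"
    unfolding qmult_def
    by (intro order_trans[OF Poly_Mapping.keys_sum] UN_mono) auto
  moreover have "op x y \<in> X" if "x \<in> X" "y \<in> X" for x y
    using assms(1) that unfolding quandle_def by simp
  ultimately show ?thesis using assms(2,3) unfolding quandle_algebra_def by blast
qed

text \<open>Derivations of a not necessarily associative algebra with carrier \<open>A\<close>, scalar
  multiplication \<open>sc\<close> and product \<open>m\<close>. Only the values of \<open>D\<close> on \<open>A\<close> matter.\<close>

definition derivation_on ::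
    "'v::ab_group_add set \<Rightarrow> ('k::field \<Rightarrow> 'v \<Rightarrow> 'v) \<Rightarrow> ('v \<Rightarrow> 'v \<Rightarrow> 'v) \<Rightarrow> ('v \<Rightarrow> 'v) \<Rightarrow> bool" where
  "derivation_on A sc m D \<longleftrightarrow>
     (\<forall>a\<in>A. D a \<in> A) \<and>
     (\<forall>a\<in>A. \<forall>b\<in>A. D (a + b) = D a + D b) \<and>
     (\<forall>c. \<forall>a\<in>A. D (sc c a) = sc c (D a)) \<and>
     (\<forall>a\<in>A. \<forall>b\<in>A. D (m a b) = m (D a) b + m a (D b))"

text \<open>Row \<open>t\<close> of the matrix holds the coordinates of \<open>D e\<^sub>t\<close>; this is the transpose of
  the usual column convention.\<close>

definition derivation_mat :: "nat \<Rightarrow> ((int \<Rightarrow>\<^sub>0 'k::field) \<Rightarrow> (int \<Rightarrow>\<^sub>0 'k)) \<Rightarrow> 'k mat" where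
  "derivation_mat n D = mat n n (\<lambda>(t, x). Poly_Mapping.lookup (D (qbasis (int t))) (int x))"

definition append_cols :: "'a::zero mat \<Rightarrow> 'a mat \<Rightarrow> 'a mat" where
  "append_cols A B = four_block_mat A B (0\<^sub>m 0 (dim_col A)) (0\<^sub>m 0 (dim_col B))"

end

theory Submission
  imports Defs
begin

text \<open>Pair a function \<open>\<phi>\<close> on \<open>\<int>/n\<close> with the coordinates of \<open>D e\<^sub>i\<close> and call the result
  \<open>L\<^sub>i(\<phi>)\<close>. The Leibniz rule for \<open>e\<^sub>i \<cdot> e\<^sub>j\<close> becomes
  \<open>L\<^bsub>2j-i\<^esub>(\<phi>) = L\<^sub>i(\<phi>(2j - x)) + L\<^sub>j(\<phi>(2x - i))\<close>. For \<open>i = j\<close>, the functional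
  \<open>H(\<phi>) = L\<^sub>j(\<phi>(2x - j))\<close> is therefore odd under reflection in \<open>j\<close>, which turns the rule into
  \<open>2 H(\<phi>) = H(\<phi>(2x - j))\<close>. Since two powers \<open>2\<^sup>a\<close> and \<open>2\<^sup>b\<close> agree modulo \<open>n\<close>, iteration gives
  \<open>(2\<^sup>b - 2\<^sup>a) H = 0\<close>, so \<open>H = 0\<close> in characteristic 0. For \<open>n = 2m\<close> this says that the entries
  at \<open>x\<close> and \<open>x + m\<close> of a basis_image are opposite; moreover the Leibniz rule loses its second term, so
  that shifting the row by an even amount shifts the columns by the same amount.\<close>

section \<open>Test functions paired with algebra elements\<close>

definition pairing :: "('a \<Rightarrow> 'k::field) \<Rightarrow> ('a \<Rightarrow>\<^sub>0 'k) \<Rightarrow> 'k" where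
  "pairing \<phi> f = (\<Sum>x\<in>Poly_Mapping.keys f. Poly_Mapping.lookup f x * \<phi> x)"

lemma pairing_superset:
  assumes "finite S" "Poly_Mapping.keys f \<subseteq> S"
  shows "pairing \<phi> f = (\<Sum>x\<in>S. Poly_Mapping.lookup f x * \<phi> x)"
  unfolding pairing_def using assms
  by (intro sum.mono_neutral_left) (auto simp: in_keys_iff)

lemma pairing_add: "pairing \<phi> (f + g) = pairing \<phi> f + pairing \<phi> g"
proof -
  let ?S = "Poly_Mapping.keys f \<union> Poly_Mapping.keys g"
  have "Poly_Mapping.keys (f + g) \<subseteq> ?S" by (rule Poly_Mapping.keys_add)
  then show ?thesis
    by (simp add: pairing_superset[of ?S] lookup_add distrib_right sum.distrib)
qed

lemma pairing_sum: "pairing \<phi> (sum h S) = (\<Sum>i\<in>S. pairing \<phi> (h i))"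
  by (induction S rule: infinite_finite_induct) (auto simp: pairing_add, auto simp: pairing_def)

lemma pairing_single: "pairing \<phi> (Poly_Mapping.single x c) = c * \<phi> x"
  by (simp add: pairing_superset[of "{x}"])

lemma pairing_add_left: "pairing (\<lambda>x. \<phi> x + \<psi> x) f = pairing \<phi> f + pairing \<psi> f"
  by (simp add: pairing_def distrib_left sum.distrib)

text \<open>Dually, multiplication by a basis vector is precomposition of the test function. This
  avoids sums over preimages, which matters for the left factor, since \<open>2 * x - i\<close> need
  not be injective modulo \<open>n\<close>.\<close>

lemma pairing_qmult_qbasis_right:
  "pairing \<phi> (qmult op f (qbasis y)) = pairing (\<lambda>x. \<phi> (op x y)) f"
  by (simp add: qmult_def qbasis_def pairing_sum pairing_single, simp add: pairing_def)

lemma pairing_qmult_qbasis_left: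
  "pairing \<phi> (qmult op (qbasis x) g) = pairing (\<lambda>y. \<phi> (op x y)) g"
  by (simp add: qmult_def qbasis_def pairing_sum pairing_single, simp add: pairing_def)

text \<open>Recovers coordinates from test functions: the support of \<open>f\<close> meets each
  residue class in at most its least nonnegative member.\<close>

lemma pairing_residue_class:
  assumes "f \<in> quandle_algebra (dihedral_set n)" "n > 0"
  shows "pairing (\<lambda>x. of_bool (x mod int n = y mod int n)) f = Poly_Mapping.lookup f (y mod int n)"
proof -
  have "Poly_Mapping.keys f \<subseteq> {0..<int n}"
    using assms(1) by (simp add: quandle_algebra_def dihedral_set_def)
  then have "pairing (\<lambda>x. of_bool (x mod int n = y mod int n)) f
    = (\<Sum>x\<in>{0..<int n}. Poly_Mapping.lookup f x * of_bool (x mod int n = y mod int n))"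
    by (intro pairing_superset) auto
  also have "\<dots> = (\<Sum>x\<in>{0..<int n}. if x = y mod int n then Poly_Mapping.lookup f x else 0)"
    by (intro sum.cong) auto
  finally show ?thesis using assms(2) by simp
qed

text \<open>Pigeonhole on residues. Two exponents are compared, rather than a power with 1, because
  2 is not invertible modulo an even \<open>n\<close>.\<close>

lemma powers_of_two_agree_mod:
  assumes "n > 0"
  shows "\<exists>a b. a < b \<and> (2::int) ^ a mod int n = 2 ^ b mod int n"
proof -
  have "finite (range (\<lambda>r. (2::int) ^ r mod int n))"
    by (rule finite_subset[of _ "{0..<int n}"]) (use assms in auto)
  then have "\<not> inj (\<lambda>r::nat. (2::int) ^ r mod int n)"
    using finite_imageD infinite_UNIV_nat by blast
  then obtain a b :: nat where "a \<noteq> b" "(2::int) ^ a mod int n = 2 ^ b mod int n"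
    unfolding inj_def by blast
  then show ?thesis by (metis linorder_neq_iff)
qed

section \<open>The Leibniz rule on periodic test functions\<close>

locale dihedral_derivation =
  fixes n :: nat and D :: "(int \<Rightarrow>\<^sub>0 'k::field_char_0) \<Rightarrow> (int \<Rightarrow>\<^sub>0 'k)"
  assumes n_pos: "n > 0"
    and deriv: "derivation_on (quandle_algebra (dihedral_set n)) qscale (qmult (dihedral_op n)) D"
begin

definition basis_image :: "int \<Rightarrow> int \<Rightarrow>\<^sub>0 'k" where
  "basis_image i = D (qbasis (i mod int n))"

definition L :: "int \<Rightarrow> (int \<Rightarrow> 'k) \<Rightarrow> 'k" where
  "L i \<phi> = pairing \<phi> (basis_image i)"

text \<open>These are the functions on \<int>/n, kept on all integers so that indices such as
  \<open>2 * j - x\<close> need no reduction.\<close>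

definition periodic :: "(int \<Rightarrow> 'k) \<Rightarrow> bool" where
  "periodic \<phi> \<longleftrightarrow> (\<forall>x y. x mod int n = y mod int n \<longrightarrow> \<phi> x = \<phi> y)"

lemma periodicD: "periodic \<phi> \<Longrightarrow> x mod int n = y mod int n \<Longrightarrow> \<phi> x = \<phi> y"
  unfolding periodic_def by blast

lemma periodic_affine: "periodic \<phi> \<Longrightarrow> periodic (\<lambda>x. \<phi> (a * x + b))"
  unfolding periodic_def by (metis mod_add_left_eq mod_mult_right_eq)

lemma periodic_residue_class: "periodic (\<lambda>x. of_bool (x mod int n = y))"
  by (simp add: periodic_def)

lemma qbasis_mem: "qbasis (i mod int n) \<in> quandle_algebra (dihedral_set n)"
  using n_pos by (simp add: quandle_algebra_def dihedral_set_def qbasis_def)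

lemma basis_image_mem: "basis_image i \<in> quandle_algebra (dihedral_set n)"
  using deriv qbasis_mem unfolding derivation_on_def basis_image_def by blast

lemma L_leibniz:
  assumes "periodic \<phi>"
  shows "L (2 * j - i) \<phi> = L i (\<lambda>x. \<phi> (2 * j - x)) + L j (\<lambda>x. \<phi> (2 * x - i))"
proof -
  let ?i = "i mod int n" and ?j = "j mod int n"
  have "dihedral_op n ?i ?j = (2 * j - i) mod int n"
    unfolding dihedral_op_def by (rule mod_diff_cong) (simp_all add: mod_mult_right_eq)
  then have "basis_image (2 * j - i) = D (qmult (dihedral_op n) (qbasis ?i) (qbasis ?j))"
    by (simp add: basis_image_def qmult_qbasis)
  also have "\<dots> = qmult (dihedral_op n) (basis_image i) (qbasis ?j) + qmult (dihedral_op n) (qbasis ?i) (basis_image j)"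
    using deriv qbasis_mem unfolding derivation_on_def basis_image_def by blast
  finally have "L (2 * j - i) \<phi> = L i (\<lambda>x. \<phi> (dihedral_op n x ?j)) + L j (\<lambda>x. \<phi> (dihedral_op n ?i x))"
    by (simp add: L_def pairing_add pairing_qmult_qbasis_right pairing_qmult_qbasis_left)
  moreover have "\<phi> (dihedral_op n x ?j) = \<phi> (2 * j - x)" for x
    by (rule periodicD[OF assms]) (simp add: dihedral_op_def, rule mod_diff_cong, simp_all add: mod_mult_right_eq)
  moreover have "\<phi> (dihedral_op n ?i x) = \<phi> (2 * x - i)" for x
    by (rule periodicD[OF assms]) (simp add: dihedral_op_def mod_diff_right_eq)
  ultimately show ?thesis by simp
qed

lemma L_doubling_step:
  assumes "periodic \<phi>"
  shows "2 * L j (\<lambda>x. \<phi> (2 * x - j)) = L j (\<lambda>x. \<phi> (2 * (2 * x - j) - j))"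
proof -
  have reflected: "periodic (\<lambda>x. \<phi> (2 * j - x))" and doubled: "periodic (\<lambda>x. \<phi> (2 * x - j))"
    using periodic_affine[OF assms, of "-1" "2 * j"] periodic_affine[OF assms, of 2 "- j"] by simp_all
  \<comment> \<open>The first two equations sum to \<open>L j (\<lambda>x. \<phi> (3 * j - 2 * x)) =
    - L j (\<lambda>x. \<phi> (2 * x - j))\<close>; inserting this into the third doubles the left
    side.\<close>
  have "L j \<phi> = L j (\<lambda>x. \<phi> (2 * j - x)) + L j (\<lambda>x. \<phi> (2 * x - j))"
    using L_leibniz[OF assms, of j j] by simp
  moreover have "L j (\<lambda>x. \<phi> (2 * j - x)) = L j \<phi> + L j (\<lambda>x. \<phi> (3 * j - 2 * x))"
    using L_leibniz[OF reflected, of j j] by (simp add: algebra_simps)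
  moreover have "L j (\<lambda>x. \<phi> (2 * x - j)) =
      L j (\<lambda>x. \<phi> (3 * j - 2 * x)) + L j (\<lambda>x. \<phi> (2 * (2 * x - j) - j))"
    using L_leibniz[OF doubled, of j j] by (simp add: algebra_simps)
  ultimately show ?thesis by (simp add: algebra_simps)
qed

text \<open>The map \<open>2 * x - j\<close> is doubling about its fixed point \<open>j\<close>, so
  its iterates scale \<open>x - j\<close> by powers of 2. Each induction step replaces \<phi> by its
  composite with this map.\<close>

lemma L_doubling_power:
  assumes "periodic \<phi>"
  shows "2 ^ r * L j (\<lambda>x. \<phi> (2 * x - j)) = L j (\<lambda>x. \<phi> (2 ^ r * (2 * (x - j)) + j))"
  using assms
proof (induction r arbitrary: \<phi>)
  case 0
  then show ?case by (simp add: algebra_simps)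
next
  case (Suc r)
  have "periodic (\<lambda>x. \<phi> (2 * x - j))"
    using periodic_affine[OF Suc.prems, of 2 "- j"] by simp
  have "2 ^ Suc r * L j (\<lambda>x. \<phi> (2 * x - j)) = 2 ^ r * (2 * L j (\<lambda>x. \<phi> (2 * x - j)))"
    by simp
  also have "\<dots> = L j (\<lambda>x. \<phi> (2 * (2 ^ r * (2 * (x - j)) + j) - j))"
    unfolding L_doubling_step[OF Suc.prems] by (rule Suc.IH[OF \<open>periodic (\<lambda>x. \<phi> (2 * x - j))\<close>])
  finally show ?case by (simp add: algebra_simps)
qed

lemma L_doubling_zero:
  assumes "periodic \<phi>"
  shows "L j (\<lambda>x. \<phi> (2 * x - i)) = 0"
proof -
  \<comment> \<open>This translation recentres the doubling at \<open>j\<close>: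
    \<open>\<psi> (2 * x - j) = \<phi> (2 * x - i)\<close>.\<close>
  define \<psi> where "\<psi> x = \<phi> (x + (j - i))" for x
  have \<psi>: "periodic \<psi>" unfolding \<psi>_def
    using periodic_affine[OF assms, of 1 "j - i"] by simp
  obtain a b where ab: "a < b" "(2::int) ^ a mod int n = 2 ^ b mod int n"
    using powers_of_two_agree_mod[OF n_pos] by blast
  have "\<psi> (2 ^ a * (2 * (x - j)) + j) = \<psi> (2 ^ b * (2 * (x - j)) + j)" for x
    by (intro periodicD[OF \<psi>] mod_add_cong mod_mult_cong ab refl)
  then have "(2::'k) ^ a * L j (\<lambda>x. \<psi> (2 * x - j)) = 2 ^ b * L j (\<lambda>x. \<psi> (2 * x - j))"
    by (simp add: L_doubling_power[OF \<psi>])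
  \<comment> \<open>Characteristic 0 enters here: distinct naturals stay distinct in the
    field.\<close>
  moreover have "(2::'k) ^ a \<noteq> 2 ^ b"
  proof -
    have "(2::nat) ^ a \<noteq> 2 ^ b" using ab(1) by simp
    then show ?thesis by (metis of_nat_eq_iff of_nat_numeral of_nat_power)
  qed
  ultimately have "L j (\<lambda>x. \<psi> (2 * x - j)) = 0" by simp
  then show ?thesis by (simp add: \<psi>_def algebra_simps)
qed

text \<open>Without its second term the Leibniz rule is equivariance under reflections. Reflecting
  in \<open>i + d\<close> and then in \<open>i\<close>, which fixes row \<open>i\<close>, composes
  to translation by \<open>2 * d\<close>.\<close>

lemma L_shift_even:
  assumes "periodic \<phi>"
  shows "L (i + 2 * d) \<phi> = L i (\<lambda>x. \<phi> (x + 2 * d))"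
proof -
  have reflect: "L (2 * j - i) \<psi> = L i (\<lambda>x. \<psi> (2 * j - x))" if "periodic \<psi>" for j \<psi>
    using L_leibniz[OF that, of j i] L_doubling_zero[OF that, of j i] by simp
  have "periodic (\<lambda>x. \<phi> (2 * (i + d) - x))"
    using periodic_affine[OF assms, of "-1" "2 * (i + d)"] by simp
  from reflect[OF this, of i] reflect[OF assms, of "i + d"]
  show ?thesis by (simp add: algebra_simps)
qed

section \<open>Symmetries of the coordinates\<close>

lemma L_residue_class:
  "L i (\<lambda>x. of_bool (x mod int n = y mod int n)) = Poly_Mapping.lookup (basis_image i) (y mod int n)"
  unfolding L_def by (rule pairing_residue_class[OF basis_image_mem n_pos])

text \<open>Doubling modulo \<open>2 * m\<close> is two-to-one, with fibre \<open>y\<close>,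
  \<open>y + m\<close> over \<open>2 * y\<close>. Pulling back the indicator of that class gives the
  sum of two indicators, which \<open>L_doubling_zero\<close> kills.\<close>

lemma lookup_row_half_shift:
  assumes "n = 2 * m"
  shows "Poly_Mapping.lookup (basis_image j) ((y + int m) mod int n) = - Poly_Mapping.lookup (basis_image j) (y mod int n)"
proof -
  have iff: "2 * x mod int n = 2 * y mod int n \<longleftrightarrow>
      x mod int n = y mod int n \<or> x mod int n = (y + int m) mod int n" for x
  proof -
    have "2 * x mod int n = 2 * y mod int n \<longleftrightarrow> int m dvd x - y"
      by (simp add: assms mod_eq_dvd_iff flip: right_diff_distrib)
    also have "\<dots> \<longleftrightarrow> int n dvd x - y \<or> int n dvd x - (y + int m)"
    proof
      assume "int m dvd x - y"
      then obtain q where q: "x - y = int m * q" by (elim dvdE)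
      show "int n dvd x - y \<or> int n dvd x - (y + int m)"
      proof (cases "even q")
        case True
        then show ?thesis using q by (auto simp: assms elim!: evenE)
      next
        case False
        then obtain p where "q = 2 * p + 1" by (elim oddE)
        then have "x - (y + int m) = int n * p" using q by (simp add: assms algebra_simps)
        then show ?thesis by simp
      qed
    next
      assume "int n dvd x - y \<or> int n dvd x - (y + int m)"
      moreover have "int m dvd int n" by (simp add: assms)
      ultimately have "int m dvd x - y \<or> int m dvd x - y - int m"
        unfolding diff_diff_eq by (blast intro: dvd_trans)
      then show "int m dvd x - y"
        using zdvd_zdiffD[of "int m" "x - y" "int m"] dvd_refl[of "int m"] by blast
    qed
    finally show ?thesis by (simp add: mod_eq_dvd_iff)
  qed
  have m: "m > 0" using n_pos assms by simp
  \<comment> \<open>Distinctness of the two classes makes the indicator of their union the sum of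
    their indicators.\<close>
  have ne: "y mod int n \<noteq> (y + int m) mod int n"
  proof
    assume "y mod int n = (y + int m) mod int n"
    then have "int n dvd int m" by (simp add: mod_eq_dvd_iff)
    then show False using m assms by (auto dest!: zdvd_imp_le)
  qed
  have "0 = L j (\<lambda>x. of_bool (2 * x mod int n = 2 * y mod int n))"
    using L_doubling_zero[OF periodic_residue_class[of "2 * y mod int n"], of j 0]
    by (simp only: diff_0_right)
  also have "\<dots> = L j (\<lambda>x. of_bool (x mod int n = y mod int n) +
      of_bool (x mod int n = (y + int m) mod int n))"
  proof -
    have "of_bool (P \<or> Q) = (of_bool P + of_bool Q :: 'k)" if "\<not> (P \<and> Q)" for P Q
      using that by auto
    then have "of_bool (2 * x mod int n = 2 * y mod int n) =
        (of_bool (x mod int n = y mod int n) + of_bool (x mod int n = (y + int m) mod int n) :: 'k)" for x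
      unfolding iff using ne by metis
    then show ?thesis by presburger
  qed
  also have "\<dots> = Poly_Mapping.lookup (basis_image j) (y mod int n) +
      Poly_Mapping.lookup (basis_image j) ((y + int m) mod int n)"
    using L_residue_class by (simp add: L_def pairing_add_left)
  finally show ?thesis by (simp add: eq_neg_iff_add_eq_0 add.commute)
qed

lemma lookup_row_shift_even:
  "Poly_Mapping.lookup (basis_image (i + 2 * d)) ((y + 2 * d) mod int n) = Poly_Mapping.lookup (basis_image i) (y mod int n)"
proof -
  have "(x + 2 * d) mod int n = (y + 2 * d) mod int n \<longleftrightarrow> x mod int n = y mod int n" for x
    by (simp add: mod_eq_dvd_iff)
  then show ?thesis
    using L_shift_even[OF periodic_residue_class, of i d "(y + 2 * d) mod int n"]
    by (simp only: L_residue_class)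
qed

section \<open>Matrix entries and blocks\<close>

lemma derivation_mat_nth:
  assumes "t < n" "x < n"
  shows "derivation_mat n D $$ (t, x) = Poly_Mapping.lookup (basis_image (int t)) (int x mod int n)"
  using assms by (simp add: derivation_mat_def basis_image_def)

lemma derivation_mat_half_column:
  assumes "n = 2 * m" "t < n" "x < m"
  shows "derivation_mat n D $$ (t, x + m) = - derivation_mat n D $$ (t, x)"
proof -
  have "x < n" "x + m < n" using assms by simp_all
  then show ?thesis
    using lookup_row_half_shift[OF assms(1), of "int t" "int x"]
    by (simp only: derivation_mat_nth assms(2) of_nat_add)
qed

text \<open>For \<open>n = 4 * k\<close> the shift \<open>2 * k\<close> is both even and half the
  modulus: moving the row by it moves the columns by it, and that half turn flips the sign.\<close>

lemma derivation_mat_half_row: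
  assumes "n = 4 * k" "t < 2 * k" "x < n"
  shows "derivation_mat n D $$ (t + 2 * k, x) = - derivation_mat n D $$ (t, x)"
proof -
  have "Poly_Mapping.lookup (basis_image (int t + 2 * int k)) (int x mod int n) =
      Poly_Mapping.lookup (basis_image (int t)) ((int x - 2 * int k) mod int n)"
    using lookup_row_shift_even[of "int t" "int k" "int x - 2 * int k"] by simp
  also have "\<dots> = - Poly_Mapping.lookup (basis_image (int t)) (int x mod int n)"
    using lookup_row_half_shift[of "2 * k" "int t" "int x - 2 * int k"] assms(1) by simp
  also have "int t + 2 * int k = int (t + 2 * k)" by simp
  moreover have "t < n" "t + 2 * k < n" using assms by simp_all
  ultimately show ?thesis
    using assms(3) by (simp only: derivation_mat_nth)
qed

end

theorem corollary3p10:
  fixes n :: nat and D :: "(int \<Rightarrow>\<^sub>0 'k::field_char_0) \<Rightarrow> (int \<Rightarrow>\<^sub>0 'k)"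
  assumes "derivation_on (quandle_algebra (dihedral_set n)) qscale (qmult (dihedral_op n)) D"
  shows "(\<forall>k. k > 0 \<and> n = 4 * k \<longrightarrow>
            (\<exists>P \<in> carrier_mat (2 * k) (2 * k).
               derivation_mat n D = four_block_mat P (- P) (- P) P)) \<and>
         (\<forall>k. odd k \<and> n = 2 * k \<longrightarrow>
            (\<exists>R \<in> carrier_mat (2 * k) k. derivation_mat n D = append_cols R (- R)))"
proof (intro conjI allI impI)
  let ?M = "derivation_mat n D"
  have dim: "dim_row ?M = n" "dim_col ?M = n" by (simp_all add: derivation_mat_def)
  {
    fix k assume k: "k > 0 \<and> n = 4 * k"
    then interpret dihedral_derivation n D
      using assms by unfold_locales auto
    let ?P = "mat (2 * k) (2 * k) (($$) ?M)"
    have col: "?M $$ (t, x) = - ?M $$ (t, x - 2 * k)" if "t < n" "x < n" "\<not> x < 2 * k" for t x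
      using derivation_mat_half_column[of "2 * k" t "x - 2 * k"] k that by simp
    have row: "?M $$ (t, x) = - ?M $$ (t - 2 * k, x)" if "t < n" "x < n" "\<not> t < 2 * k" for t x
      using derivation_mat_half_row[of k "t - 2 * k" x] k that by simp
    have "?M = four_block_mat ?P (- ?P) (- ?P) ?P"
    proof (rule eq_matI)
      fix t x assume "t < dim_row (four_block_mat ?P (- ?P) (- ?P) ?P)"
        "x < dim_col (four_block_mat ?P (- ?P) (- ?P) ?P)"
      then have tx: "t < n" "x < n" using k by simp_all
      show "?M $$ (t, x) = four_block_mat ?P (- ?P) (- ?P) ?P $$ (t, x)"
      proof (cases "t < 2 * k")
        case True
        then show ?thesis using tx k col[OF tx] by simp
      next
        \<comment> \<open>In the lower right block \<open>row\<close> leads to row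
          \<open>t - 2 * k\<close>, where \<open>col\<close> contributes a second sign; the two
          cancel.\<close>
        case False
        have "t - 2 * k < n" using tx by simp
        from False show ?thesis using tx k row[OF tx] col[OF \<open>t - 2 * k < n\<close> tx(2)] by simp
      qed
    qed (use k dim in simp_all)
    then show "\<exists>P \<in> carrier_mat (2 * k) (2 * k). ?M = four_block_mat P (- P) (- P) P"
      by (intro bexI[of _ ?P]) simp_all
  next
    fix k assume k: "odd k \<and> n = 2 * k"
    then interpret dihedral_derivation n D
      \<comment> \<open>Oddness gives \<open>k > 0\<close>, hence the positive modulus that the
        locale requires.\<close>
      using assms by unfold_locales (auto intro: odd_pos)
    let ?R = "mat (2 * k) k (($$) ?M)"
    have col: "?M $$ (t, x) = - ?M $$ (t, x - k)" if "t < n" "x < n" "\<not> x < k" for t x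
      using derivation_mat_half_column[of k t "x - k"] k that by simp
    have "?M = append_cols ?R (- ?R)"
      by (rule eq_matI) (use k dim col in \<open>auto simp: append_cols_def\<close>)
    then show "\<exists>R \<in> carrier_mat (2 * k) k. ?M = append_cols R (- R)"
      by (intro bexI[of _ ?R]) simp_all
  }
qed

end
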